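(* Let $T$ be a rooted, countably infinite and locally finite tree and let $B$ be the backward shift. The following are equivalent: (1) $B$ is a bounded operator from $\mathcal{L}$ to $\mathcal{L}$; (2) $B$ is a bounded operator from $\mathcal{L}_0$ to $\mathcal{L}_0$; (3) $T$ is homogeneous by sectors; (4) $\sup\{\,|\gamma(v)-\gamma(\mathrm{par}(v))|\,|v| : v\in T^*\,\}<\infty$. Moreover, in this case, $\|B\|\le\max\{2\gamma(o),\Lambda\}$ (for $B$ on $\mathcal{L}$ and for $B$ on $\mathcal{L}_0$), where $$\Lambda=\sup\{\gamma(v)+\gamma(\mathrm{par}(v))-1+|\gamma(v)-1|+|\gamma(v)-\gamma(\mathrm{par}(v))|\,|v| : v\in T^*\}.$$
   Context: A tree is an undirected graph (no loops or multiple edges) in which any two vertices are joined by exactly one path; $T$ also denotes its vertex set. It is locally finite if every vertex has finite degree. $T$ has a distinguished vertex $o$, the root; $|v|$ is the length (number of edges) of the path from $o$ to $v$; $T^*=T\setminus\{o\}$. For $v\in T^*$, the parent $\mathrm{par}(v)$ is the vertex preceding $v$ on the unique path from $o$ to $v$; $\mathrm{Chi}(v)$ is the set of children of $v$ (vertices with parent $v$), and $\gamma(v)$ is its cardinality. The sector $S_v$ is the set consisting of $v$ and all its descendants (children, children of children, etc.). $T$ is homogeneous by sectors (at the level $N$) if there is $N\in\mathbb{N}_0=\{0,1,2,\dots\}$ such that for all $v\in T$ with $|v|=N$ we have $\gamma(w)=\gamma(v)$ for each $w\in S_v$. For $f:T\to\mathbb{C}$ define $f':T\to\mathbb{C}$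 by $f'(o)=f(o)$ and $f'(v)=f(v)-f(\mathrm{par}(v))$ for $v\neq o$. The Lipschitz space $\mathcal{L}$ is the Banach space of all $f:T\to\mathbb{C}$ with $f'$ bounded, with norm $\|f\|=\sup_{v\in T}|f'(v)|$. The little Lipschitz space $\mathcal{L}_0$ is the closed subspace of all $f$ with $\lim_{|v|\to\infty}f'(v)=0$, with the same norm. The backward shift is defined on functions $f:T\to\mathbb{C}$ by $(Bf)(v)=\sum_{w\in\mathrm{Chi}(v)}f(w)$ (empty sum equal to $0$). "$B$ is bounded from $X$ to $X$" includes that $B$ maps $X$ into $X$. *)

theory Defs
  imports "HOL-Analysis.Analysis"
begin

text \<open>The vertices are the elements of the type \<open>'a\<close>; a graph is given by its adjacency relation
  \<open>E\<close>.  A path is the nonempty list of the distinct vertices that it visits, so that its number of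
  edges is one less than the length of the list.\<close>

definition is_path :: "('a \<Rightarrow> 'a \<Rightarrow> bool) \<Rightarrow> 'a \<Rightarrow> 'a list \<Rightarrow> 'a \<Rightarrow> bool" where
  "is_path E u p v \<longleftrightarrow> p \<noteq> [] \<and> hd p = u \<and> last p = v \<and> distinct p \<and> successively E p"

definition is_tree :: "('a \<Rightarrow> 'a \<Rightarrow> bool) \<Rightarrow> bool" where
  "is_tree E \<longleftrightarrow> symp E \<and> irreflp E \<and> (\<forall>u v. \<exists>!p. is_path E u p v)"

definition locally_finite :: "('a \<Rightarrow> 'a \<Rightarrow> bool) \<Rightarrow> bool" where
  "locally_finite E \<longleftrightarrow> (\<forall>v. finite {w. E v w})"

definition tree_path :: "('a \<Rightarrow> 'a \<Rightarrow> bool) \<Rightarrow> 'a \<Rightarrow> 'a \<Rightarrow> 'a list" where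
  "tree_path E u v = (THE p. is_path E u p v)"

text \<open>In the following, \<open>r\<close> is the root.\<close>

definition level :: "('a \<Rightarrow> 'a \<Rightarrow> bool) \<Rightarrow> 'a \<Rightarrow> 'a \<Rightarrow> nat" where
  "level E r v = length (tree_path E r v) - 1"

text \<open>The value \<open>par E r r\<close> is unspecified and never used.\<close>

definition par :: "('a \<Rightarrow> 'a \<Rightarrow> bool) \<Rightarrow> 'a \<Rightarrow> 'a \<Rightarrow> 'a" where
  "par E r v = last (butlast (tree_path E r v))"

definition Chi :: "('a \<Rightarrow> 'a \<Rightarrow> bool) \<Rightarrow> 'a \<Rightarrow> 'a \<Rightarrow> 'a set" where
  "Chi E r v = {w. w \<noteq> r \<and> par E r w = v}"

definition num_children :: "('a \<Rightarrow> 'a \<Rightarrow> bool) \<Rightarrow> 'a \<Rightarrow> 'a \<Rightarrow> nat" where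
  "num_children E r v = card (Chi E r v)"

definition sector :: "('a \<Rightarrow> 'a \<Rightarrow> bool) \<Rightarrow> 'a \<Rightarrow> 'a \<Rightarrow> 'a set" where
  "sector E r v = {w. (\<lambda>x y. y \<in> Chi E r x)\<^sup>*\<^sup>* v w}"

definition homogeneous_by_sectors :: "('a \<Rightarrow> 'a \<Rightarrow> bool) \<Rightarrow> 'a \<Rightarrow> bool" where
  "homogeneous_by_sectors E r \<longleftrightarrow>
    (\<exists>N. \<forall>v. level E r v = N \<longrightarrow> (\<forall>w\<in>sector E r v. num_children E r w = num_children E r v))"

definition tree_deriv :: "('a \<Rightarrow> 'a \<Rightarrow> bool) \<Rightarrow> 'a \<Rightarrow> ('a \<Rightarrow> complex) \<Rightarrow> 'a \<Rightarrow> complex" where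
  "tree_deriv E r f v = (if v = r then f r else f v - f (par E r v))"

definition Lip :: "('a \<Rightarrow> 'a \<Rightarrow> bool) \<Rightarrow> 'a \<Rightarrow> ('a \<Rightarrow> complex) set" where
  "Lip E r = {f. bounded (range (tree_deriv E r f))}"

definition little_Lip :: "('a \<Rightarrow> 'a \<Rightarrow> bool) \<Rightarrow> 'a \<Rightarrow> ('a \<Rightarrow> complex) set" where
  "little_Lip E r = {f \<in> Lip E r. (tree_deriv E r f \<longlongrightarrow> 0) (filtercomap (level E r) at_top)}"

definition Lip_norm :: "('a \<Rightarrow> 'a \<Rightarrow> bool) \<Rightarrow> 'a \<Rightarrow> ('a \<Rightarrow> complex) \<Rightarrow> real" where
  "Lip_norm E r f = (SUP v. norm (tree_deriv E r f v))"

definition backward_shift ::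
    "('a \<Rightarrow> 'a \<Rightarrow> bool) \<Rightarrow> 'a \<Rightarrow> ('a \<Rightarrow> complex) \<Rightarrow> ('a \<Rightarrow> complex)" where
  "backward_shift E r f v = (\<Sum>w\<in>Chi E r v. f w)"

text \<open>Operators on a space \<open>X\<close> of complex functions with norm \<open>nrm\<close>.  The operator norm is a
  supremum of reals, hence meaningful only for bounded operators.\<close>

definition bounded_operator_on ::
    "('a \<Rightarrow> complex) set \<Rightarrow> (('a \<Rightarrow> complex) \<Rightarrow> real) \<Rightarrow> (('a \<Rightarrow> complex) \<Rightarrow> ('a \<Rightarrow> complex)) \<Rightarrow> bool"
  where
  "bounded_operator_on X nrm A \<longleftrightarrow>
    (\<forall>f\<in>X. A f \<in> X) \<and>
    (\<forall>f\<in>X. \<forall>g\<in>X. A (\<lambda>v. f v + g v) = (\<lambda>v. A f v + A g v)) \<and>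
    (\<forall>c. \<forall>f\<in>X. A (\<lambda>v. c * f v) = (\<lambda>v. c * A f v)) \<and>
    (\<exists>C. \<forall>f\<in>X. nrm (A f) \<le> C * nrm f)"

definition operator_norm_on ::
    "('a \<Rightarrow> complex) set \<Rightarrow> (('a \<Rightarrow> complex) \<Rightarrow> real) \<Rightarrow> (('a \<Rightarrow> complex) \<Rightarrow> ('a \<Rightarrow> complex)) \<Rightarrow> real"
  where
  "operator_norm_on X nrm A = (SUP f\<in>{f\<in>X. nrm f \<le> 1}. nrm (A f))"

definition Lambda_bound :: "('a \<Rightarrow> 'a \<Rightarrow> bool) \<Rightarrow> 'a \<Rightarrow> ereal" where
  "Lambda_bound E r = (SUP v\<in>- {r}. ereal (
      real (num_children E r v) + real (num_children E r (par E r v)) - 1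
      + \<bar>real (num_children E r v) - 1\<bar>
      + \<bar>real (num_children E r v) - real (num_children E r (par E r v))\<bar> * real (level E r v)))"

end

theory Submission
  imports Defs
begin

text \<open>Write \<open>\<gamma> v\<close> for the number of children of \<open>v\<close> and \<open>f'\<close> for the discrete derivative.  Everything
  rests on one identity (\<open>tree_deriv_shift\<close>): for \<open>v \<noteq> r\<close> with parent \<open>p\<close>,

  \<open>(B f)' v = (\<Sum>w \<in> Chi v. f' w) - (\<Sum>u \<in> Chi p - {v}. f' u) + (\<gamma> v - 1) f' v + (\<gamma> v - \<gamma> p) f p\<close>.

  If \<open>\<bar>f'\<bar> \<le> K\<close>, then \<open>\<bar>f p\<bar> \<le> K \<bar>v\<bar>\<close>, because \<open>f p\<close> is the sum of the \<open>\<bar>v\<bar>\<close> values of \<open>f'\<close> on the path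
  from the root to \<open>p\<close>.  The triangle inequality thus bounds \<open>(B f)' v\<close> by \<open>K\<close> times the term of
  \<open>\<Lambda>\<close> at \<open>v\<close>, while \<open>\<bar>(B f) r\<bar> \<le> 2 K \<gamma> r\<close>; this is the norm estimate (\<open>shift_Lip_norm_le\<close>).

  The jump \<open>\<gamma> v - \<gamma> p\<close> is an integer.  Hence \<open>\<bar>\<gamma> v - \<gamma> p\<bar> \<bar>v\<bar>\<close> can only be bounded if the jumps vanish
  on all high levels, and the converse holds because a locally finite tree has finitely many vertices
  up to any level.  Vanishing of the jumps beyond some level is just homogeneity by sectors
  (\<open>homogeneous_by_sectors_iff_jumps_vanish\<close>).  In that case \<open>\<gamma>\<close> is bounded, so \<open>\<Lambda>\<close> is finite, and on
  high levels the last summand of the identity disappears, so that \<open>B\<close> preserves the decay of \<open>f'\<close> too.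

  Conversely, functions in the little Lipschitz space already detect the jumps
  (\<open>jumps_bounded_if_shift_bounded\<close>).  The indicator function of \<open>Chi v\<close> is sent to \<open>\<gamma> v\<close> times that
  of \<open>{v}\<close>, so \<open>\<gamma>\<close> is at most the norm of \<open>B\<close>; the truncated level \<open>f v = min \<bar>v\<bar> n\<close> gives
  \<open>(B f)' v = (\<gamma> v - \<gamma> p) \<bar>v\<bar> + \<gamma> v\<close> for \<open>\<bar>v\<bar> < n\<close>.  As these functions lie in both spaces, one
  argument serves for both operators.\<close>

section \<open>Parents, children and levels\<close>

locale rooted_tree =
  fixes E :: "'a \<Rightarrow> 'a \<Rightarrow> bool" and r :: 'a
  assumes tree: "is_tree E" and locfin: "locally_finite E"
begin

abbreviation "lev \<equiv> level E r"
abbreviation "parent \<equiv> par E r"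
abbreviation "chi \<equiv> Chi E r"
abbreviation "\<gamma> \<equiv> num_children E r"
abbreviation "D \<equiv> tree_deriv E r"
abbreviation "B \<equiv> backward_shift E r"

lemma ex1_path: "\<exists>!p. is_path E u p v"
  using tree by (auto simp: is_tree_def)

lemma tree_path: "is_path E u (tree_path E u v) v"
  unfolding tree_path_def by (rule theI'[OF ex1_path])

lemma tree_path_unique: "is_path E u p v \<Longrightarrow> tree_path E u v = p"
  using ex1_path tree_path by blast

lemma level_root [simp]: "lev r = 0"
proof -
  have "is_path E r [r] r" by (simp add: is_path_def)
  then show ?thesis using tree_path_unique by (simp add: level_def)
qed

text \<open>Cutting off the last vertex of the path to \<open>v\<close> leaves a path to the last but one, which is the
  parent; by uniqueness it is the path to the parent.\<close>

lemma tree_path_parent: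
  assumes "v \<noteq> r"
  shows "tree_path E r v = tree_path E r (parent v) @ [v]" and "E (parent v) v"
proof -
  let ?p = "tree_path E r v"
  have p: "?p \<noteq> []" "hd ?p = r" "last ?p = v" "distinct ?p" "successively E ?p"
    using tree_path[of r v] by (auto simp: is_path_def)
  define q where "q = butlast ?p"
  have pq: "?p = q @ [v]" using p unfolding q_def by (metis append_butlast_last_id)
  have q: "q \<noteq> []" using pq p assms by auto
  have "is_path E r q (parent v)"
    using p q unfolding pq
    by (auto simp: is_path_def par_def pq successively_append_iff)
  then show "?p = tree_path E r (parent v) @ [v]"
    using pq tree_path_unique by simp
  show "E (parent v) v"
    using p q unfolding pq
    by (auto simp: par_def pq successively_append_iff)
qed

lemma level_parent: "v \<noteq> r \<Longrightarrow> lev v = Suc (lev (parent v))"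
  using tree_path_parent(1)[of v] tree_path[of r "parent v"]
  by (auto simp: level_def is_path_def)

lemma level_chi: "w \<in> chi v \<Longrightarrow> lev w = Suc (lev v)"
  using level_parent by (auto simp: Chi_def)

lemma in_chi_parent: "v \<noteq> r \<Longrightarrow> v \<in> chi (parent v)"
  by (simp add: Chi_def)

lemma finite_chi [simp]: "finite (chi v)"
proof (rule finite_subset)
  show "chi v \<subseteq> {w. E v w}" using tree_path_parent(2) by (auto simp: Chi_def)
  show "finite {w. E v w}" using locfin by (simp add: locally_finite_def)
qed

lemma level_0_iff: "lev v = 0 \<longleftrightarrow> v = r"
  using level_parent[of v] by (cases "v = r") auto

lemma finite_level_le: "finite {v. lev v \<le> n}"
proof (induction n)
  case 0
  then show ?case by (simp add: level_0_iff)
next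
  case (Suc n)
  have "{v. lev v \<le> Suc n} \<subseteq> insert r (\<Union>u\<in>{u. lev u \<le> n}. chi u)"
    using level_parent in_chi_parent by fastforce
  then show ?case using Suc finite_subset by fastforce
qed

lemma ex_sector_of_level:
  "n \<le> lev w \<Longrightarrow> \<exists>u. lev u = n \<and> w \<in> sector E r u"
proof (induction "lev w" arbitrary: w)
  case 0
  then show ?case by (auto simp: sector_def)
next
  case (Suc m)
  show ?case
  proof (cases "n = lev w")
    case True
    then show ?thesis by (auto simp: sector_def)
  next
    case False
    have wr: "w \<noteq> r" using Suc.hyps by auto
    then have "lev (parent w) = m" using Suc.hyps(2) level_parent by simp
    then obtain u where "lev u = n" "parent w \<in> sector E r u"
      using Suc.hyps(1)[of "parent w"] Suc.hyps(2) Suc.prems False by auto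
    then show ?thesis
      using in_chi_parent[OF wr]
      by (auto simp: sector_def intro: rtranclp.rtrancl_into_rtrancl)
  qed
qed

section \<open>Homogeneity by sectors and jumps of the number of children\<close>

text \<open>Homogeneity can be checked one edge at a time.  Every vertex of level at least \<open>N\<close> lies in the
  sector of a vertex of level \<open>N\<close>, hence the number of children is constant on those sectors if and
  only if it does not change along any edge beyond level \<open>N\<close>.\<close>

lemma homogeneous_by_sectors_iff_jumps_vanish:
  "homogeneous_by_sectors E r \<longleftrightarrow> (\<exists>N. \<forall>v. N < lev v \<longrightarrow> \<gamma> v = \<gamma> (parent v))"
proof
  assume "homogeneous_by_sectors E r"
  then obtain N where N: "\<And>u w. lev u = N \<Longrightarrow> w \<in> sector E r u \<Longrightarrow> \<gamma> w = \<gamma> u"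
    by (auto simp: homogeneous_by_sectors_def)
  have "\<gamma> v = \<gamma> (parent v)" if v: "N < lev v" for v
  proof -
    have vr: "v \<noteq> r" using v by auto
    then obtain u where u: "lev u = N" "parent v \<in> sector E r u"
      using ex_sector_of_level[of N "parent v"] level_parent[of v] v by auto
    then have "v \<in> sector E r u"
      using in_chi_parent[OF vr]
      by (auto simp: sector_def intro: rtranclp.rtrancl_into_rtrancl)
    then show ?thesis using N u by metis
  qed
  then show "\<exists>N. \<forall>v. N < lev v \<longrightarrow> \<gamma> v = \<gamma> (parent v)" by blast
next
  assume "\<exists>N. \<forall>v. N < lev v \<longrightarrow> \<gamma> v = \<gamma> (parent v)"
  then obtain N where N: "\<And>v. N < lev v \<Longrightarrow> \<gamma> v = \<gamma> (parent v)" by blast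
  have "lev v \<le> lev w \<and> \<gamma> w = \<gamma> v" if "lev v = N" "w \<in> sector E r v" for v w
    using that(2) unfolding sector_def mem_Collect_eq
  proof (induction rule: rtranclp_induct)
    case base
    then show ?case by simp
  next
    case (step y z)
    then have "lev z = Suc (lev y)" "parent z = y"
      using level_chi by (auto simp: Chi_def)
    then show ?case using step N[of z] that(1) by simp
  qed
  then show "homogeneous_by_sectors E r"
    by (auto simp: homogeneous_by_sectors_def)
qed

lemma jumps_vanish_iff_weighted_jumps_bounded:
  "(\<exists>N. \<forall>v. N < lev v \<longrightarrow> \<gamma> v = \<gamma> (parent v)) \<longleftrightarrow>
   (\<exists>C. \<forall>v\<in>- {r}. \<bar>real (\<gamma> v) - real (\<gamma> (parent v))\<bar> * real (lev v) \<le> C)"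
  (is "_ \<longleftrightarrow> (\<exists>C. \<forall>v\<in>- {r}. ?g v \<le> C)")
proof
  assume "\<exists>N. \<forall>v. N < lev v \<longrightarrow> \<gamma> v = \<gamma> (parent v)"
  then obtain N where N: "\<And>v. N < lev v \<Longrightarrow> \<gamma> v = \<gamma> (parent v)" by blast
  define C where "C = (\<Sum>v\<in>{v. lev v \<le> N}. ?g v)"
  have "?g v \<le> C" for v
  proof (cases "lev v \<le> N")
    case True
    then show ?thesis
      unfolding C_def using finite_level_le by (intro member_le_sum) auto
  next
    case False
    moreover have "0 \<le> C" unfolding C_def by (intro sum_nonneg) auto
    ultimately show ?thesis using N[of v] by simp
  qed
  then show "\<exists>C. \<forall>v\<in>- {r}. ?g v \<le> C" by blast
next
  assume "\<exists>C. \<forall>v\<in>- {r}. ?g v \<le> C"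
  then obtain C where C: "\<And>v. v \<noteq> r \<Longrightarrow> ?g v \<le> C" by auto
  have "\<gamma> v = \<gamma> (parent v)" if v: "nat \<lceil>C\<rceil> < lev v" for v
  proof (rule ccontr)
    assume "\<gamma> v \<noteq> \<gamma> (parent v)"
    \<comment> \<open>A nonzero jump is at least 1, being an integer.\<close>
    then have "1 \<le> \<bar>real (\<gamma> v) - real (\<gamma> (parent v))\<bar>" by linarith
    then have "real (lev v) \<le> ?g v" by (simp add: mult_le_cancel_right1)
    also have "?g v \<le> C" using v by (intro C) auto
    finally show False using v by linarith
  qed
  then show "\<exists>N. \<forall>v. N < lev v \<longrightarrow> \<gamma> v = \<gamma> (parent v)" by blast
qed

lemma num_children_bounded_if_jumps_vanish:
  assumes "\<And>v. N < lev v \<Longrightarrow> \<gamma> v = \<gamma> (parent v)"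
  shows "\<exists>G. \<forall>v. \<gamma> v \<le> G"
proof -
  define G where "G = (\<Sum>v\<in>{v. lev v \<le> N}. \<gamma> v)"
  have "\<gamma> v \<le> G" for v
  proof (induction "lev v" arbitrary: v rule: less_induct)
    case less
    show ?case
    proof (cases "lev v \<le> N")
      case True
      then show ?thesis
        unfolding G_def using finite_level_le by (intro member_le_sum) auto
    next
      case False
      then have "v \<noteq> r" by auto
      then have "\<gamma> (parent v) \<le> G" using less level_parent by simp
      then show ?thesis using assms False by simp
    qed
  qed
  then show ?thesis by blast
qed

section \<open>The Lipschitz norm\<close>

lemma norm_deriv_le_Lip_norm:
  assumes "f \<in> Lip E r"
  shows "norm (D f v) \<le> Lip_norm E r f"
  unfolding Lip_norm_def
proof (rule cSUP_upper)
  show "bdd_above (range (\<lambda>v. norm (D f v)))"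
    using assms by (auto simp: Lip_def bounded_iff bdd_above_def)
qed simp

lemma Lip_norm_nonneg: "f \<in> Lip E r \<Longrightarrow> 0 \<le> Lip_norm E r f"
  using norm_deriv_le_Lip_norm norm_ge_zero order_trans by blast

lemma Lip_and_norm_leI:
  assumes "\<And>v. norm (D f v) \<le> K"
  shows "f \<in> Lip E r" and "Lip_norm E r f \<le> K"
  using assms by (auto simp: Lip_def bounded_iff Lip_norm_def intro!: cSUP_least)

lemma deriv_tendsto_0_iff:
  "(D f \<longlongrightarrow> 0) (filtercomap lev at_top) \<longleftrightarrow> (\<forall>e>0. \<exists>N. \<forall>v. N \<le> lev v \<longrightarrow> norm (D f v) < e)"
  by (auto simp: tendsto_iff eventually_filtercomap_at_top_linorder)

lemma little_LipI:
  assumes "\<And>v. norm (D f v) \<le> K" and "\<And>v. N \<le> lev v \<Longrightarrow> D f v = 0"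
  shows "f \<in> little_Lip E r"
proof -
  have "\<exists>N. \<forall>v. N \<le> lev v \<longrightarrow> norm (D f v) < e" if "e > 0" for e :: real
    using assms(2) that by (intro exI[of _ N]) auto
  then show ?thesis
    using Lip_and_norm_leI(1)[of f, OF assms(1)]
    by (auto simp: little_Lip_def deriv_tendsto_0_iff)
qed

text \<open>\<open>f v\<close> is the sum of the derivatives at the \<open>lev v + 1\<close> vertices of the path from the root.\<close>

lemma norm_le_level:
  assumes "\<And>v. norm (D f v) \<le> K"
  shows "norm (f v) \<le> K * (real (lev v) + 1)"
proof (induction "lev v" arbitrary: v)
  case 0
  then have "v = r" using level_0_iff by simp
  then show ?case using assms[of r] by (simp add: tree_deriv_def)
next
  case (Suc m)
  then have v: "v \<noteq> r" "lev v = Suc (lev (parent v))" "m = lev (parent v)"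
    using level_parent[of v] by force+
  have "norm (f v) \<le> norm (D f v) + norm (f (parent v))"
    using v(1) norm_triangle_ineq[of "D f v" "f (parent v)"] by (simp add: tree_deriv_def)
  also have "\<dots> \<le> K + K * (real (lev (parent v)) + 1)"
    using assms[of v] Suc.hyps(1)[OF v(3)] by linarith
  also have "\<dots> = K * (real (lev v) + 1)" using v(2) by (simp add: algebra_simps)
  finally show ?case .
qed

section \<open>The derivative of the shifted function\<close>

lemma shift_eq_deriv_sum: "B f v = (\<Sum>w\<in>chi v. D f w) + of_nat (\<gamma> v) * f v"
proof -
  have "(\<Sum>w\<in>chi v. D f w) = (\<Sum>w\<in>chi v. f w - f v)"
    by (intro sum.cong) (auto simp: tree_deriv_def Chi_def)
  then show ?thesis
    by (simp add: backward_shift_def num_children_def sum_subtractf)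
qed

text \<open>The summand of the sibling sum that belongs to \<open>v\<close> itself is merged with \<open>\<gamma> v * f' v\<close>, which
  comes from \<open>f v = f (parent v) + f' v\<close>.  This cancellation is where the term \<open>\<bar>\<gamma> v - 1\<bar>\<close> of
  \<open>\<Lambda>\<close> originates.\<close>

lemma tree_deriv_shift:
  assumes "v \<noteq> r"
  shows "D (B f) v = (\<Sum>w\<in>chi v. D f w) - (\<Sum>u\<in>chi (parent v) - {v}. D f u)
    + (of_nat (\<gamma> v) - 1) * D f v
    + (of_nat (\<gamma> v) - of_nat (\<gamma> (parent v))) * f (parent v)"
proof -
  have 1: "(\<Sum>u\<in>chi (parent v). D f u) = D f v + (\<Sum>u\<in>chi (parent v) - {v}. D f u)"
    by (rule sum.remove[OF finite_chi in_chi_parent[OF assms]])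
  have 2: "f v = f (parent v) + D f v" using assms by (simp add: tree_deriv_def)
  have "D (B f) v = B f v - B f (parent v)" using assms by (simp add: tree_deriv_def)
  also have "\<dots> = (\<Sum>w\<in>chi v. D f w) + of_nat (\<gamma> v) * (f (parent v) + D f v)
      - (D f v + (\<Sum>u\<in>chi (parent v) - {v}. D f u) + of_nat (\<gamma> (parent v)) * f (parent v))"
    using shift_eq_deriv_sum[of f v] shift_eq_deriv_sum[of f "parent v"] 1 2 by presburger
  finally show ?thesis by (simp add: algebra_simps)
qed

lemma norm_diff_add_add_le:
  fixes a b c d :: "'b::real_normed_vector"
  shows "norm (a - b + c + d) \<le> norm a + norm b + norm c + norm d"
  by (intro norm_triangle_mono norm_triangle_ineq4 order_refl)

definition Lambda_term :: "'a \<Rightarrow> real" where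
  "Lambda_term v = real (\<gamma> v) + real (\<gamma> (parent v)) - 1 + \<bar>real (\<gamma> v) - 1\<bar>
    + \<bar>real (\<gamma> v) - real (\<gamma> (parent v))\<bar> * real (lev v)"

lemma norm_sum_deriv_le:
  assumes "\<And>w. w \<in> A \<Longrightarrow> norm (D f w) \<le> K"
  shows "norm (\<Sum>w\<in>A. D f w) \<le> real (card A) * K"
  using sum_norm_bound[of A "D f" K] assms by simp

lemma card_siblings:
  assumes "v \<noteq> r"
  shows "real (card (chi (parent v) - {v})) = real (\<gamma> (parent v)) - 1"
proof -
  have "card (chi (parent v)) = Suc (card (chi (parent v) - {v}))"
    by (metis card.remove finite_chi in_chi_parent[OF assms])
  then show ?thesis by (simp add: num_children_def)
qed

lemma norm_deriv_shift_le:
  assumes K: "\<And>v. norm (D f v) \<le> K" and v: "v \<noteq> r"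
  shows "norm (D (B f) v) \<le> Lambda_term v * K"
proof -
  have a: "norm (\<Sum>w\<in>chi v. D f w) \<le> real (\<gamma> v) * K"
    using norm_sum_deriv_le[of "chi v"] K by (simp add: num_children_def)
  have b: "norm (\<Sum>u\<in>chi (parent v) - {v}. D f u) \<le> (real (\<gamma> (parent v)) - 1) * K"
    using norm_sum_deriv_le[of "chi (parent v) - {v}" f K] K card_siblings[OF v] by simp
  have "norm (of_nat (\<gamma> v) - 1 :: complex) = \<bar>real (\<gamma> v) - 1\<bar>"
    by (metis norm_of_real of_real_diff of_real_1 of_real_of_nat_eq)
  then have c: "norm ((of_nat (\<gamma> v) - 1) * D f v) \<le> \<bar>real (\<gamma> v) - 1\<bar> * K"
    using K[of v] by (simp add: norm_mult mult_left_mono)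
  have "norm (of_nat (\<gamma> v) - of_nat (\<gamma> (parent v)) :: complex)
      = \<bar>real (\<gamma> v) - real (\<gamma> (parent v))\<bar>"
    by (metis norm_of_real of_real_diff of_real_of_nat_eq)
  moreover have "norm (f (parent v)) \<le> real (lev v) * K"
    using norm_le_level[of f K "parent v", OF K] level_parent[OF v] by (simp add: algebra_simps)
  ultimately have d: "norm ((of_nat (\<gamma> v) - of_nat (\<gamma> (parent v))) * f (parent v))
      \<le> \<bar>real (\<gamma> v) - real (\<gamma> (parent v))\<bar> * (real (lev v) * K)"
    by (simp add: norm_mult mult_left_mono)
  have "norm (D (B f) v) \<le> real (\<gamma> v) * K + (real (\<gamma> (parent v)) - 1) * K
      + \<bar>real (\<gamma> v) - 1\<bar> * K + \<bar>real (\<gamma> v) - real (\<gamma> (parent v))\<bar> * (real (lev v) * K)"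
    unfolding tree_deriv_shift[OF v]
    by (rule order_trans[OF norm_diff_add_add_le]) (intro add_mono a b c d)
  then show ?thesis by (simp add: Lambda_term_def algebra_simps)
qed

lemma norm_deriv_shift_root_le:
  assumes K: "\<And>v. norm (D f v) \<le> K"
  shows "norm (D (B f) r) \<le> 2 * real (\<gamma> r) * K"
proof -
  have "norm (f w) \<le> 2 * K" if "w \<in> chi r" for w
    using norm_le_level[of f K w, OF K] level_chi[OF that] by simp
  then have "norm (B f r) \<le> real (\<gamma> r) * (2 * K)"
    using sum_norm_bound[of "chi r" f "2 * K"] by (simp add: backward_shift_def num_children_def)
  then show ?thesis by (simp add: tree_deriv_def)
qed

lemma shift_Lip_norm_le:
  assumes "2 * real (\<gamma> r) \<le> m" and "\<And>v. v \<noteq> r \<Longrightarrow> Lambda_term v \<le> m" and f: "f \<in> Lip E r"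
  shows "B f \<in> Lip E r" and "Lip_norm E r (B f) \<le> m * Lip_norm E r f"
proof -
  have K: "\<And>v. norm (D f v) \<le> Lip_norm E r f" using norm_deriv_le_Lip_norm[OF f] .
  have "norm (D (B f) v) \<le> m * Lip_norm E r f" for v
  proof (cases "v = r")
    case True
    then show ?thesis
      using norm_deriv_shift_root_le[of f, OF K] mult_right_mono[OF assms(1) Lip_norm_nonneg[OF f]]
      by simp
  next
    case False
    then show ?thesis
      using norm_deriv_shift_le[of f, OF K False]
        mult_right_mono[OF assms(2)[OF False] Lip_norm_nonneg[OF f]]
      by simp
  qed
  from Lip_and_norm_leI[of "B f", OF this]
  show "B f \<in> Lip E r" and "Lip_norm E r (B f) \<le> m * Lip_norm E r f" .
qed

section \<open>Homogeneity implies boundedness\<close>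

text \<open>Beyond the last jump the derivative of \<open>B f\<close> at \<open>v\<close> only involves values of \<open>f'\<close> at \<open>v\<close>, its
  siblings and its children, which are at most \<open>3 G\<close> values when counted with multiplicity.\<close>

lemma shift_little_Lip:
  assumes jumps: "\<And>v. N < lev v \<Longrightarrow> \<gamma> v = \<gamma> (parent v)" and G: "\<And>v. \<gamma> v \<le> G"
    and f: "f \<in> little_Lip E r" and Bf: "B f \<in> Lip E r"
  shows "B f \<in> little_Lip E r"
proof -
  have "\<exists>M. \<forall>v. M \<le> lev v \<longrightarrow> norm (D (B f) v) < e" if e: "e > 0" for e :: real
  proof -
    define d where "d = e / (3 * real G + 1)"
    have d: "d > 0" using e by (simp add: d_def)
    obtain M where M: "\<And>v. M \<le> lev v \<Longrightarrow> norm (D f v) < d"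
      using f d unfolding little_Lip_def deriv_tendsto_0_iff by blast
    have "norm (D (B f) v) < e" if v: "max M (Suc N) \<le> lev v" for v
    proof -
      have vr: "v \<noteq> r" using v by auto
      have eq: "\<gamma> v = \<gamma> (parent v)" using jumps v by simp
      have g1: "1 \<le> real (\<gamma> v)" using card_siblings[OF vr] eq by simp
      have gG: "real (\<gamma> v) \<le> real G" using G by simp
      have a: "norm (\<Sum>w\<in>chi v. D f w) \<le> real (\<gamma> v) * d"
        unfolding num_children_def
        using M v level_chi by (intro norm_sum_deriv_le) (force intro: less_imp_le)
      have b: "norm (\<Sum>u\<in>chi (parent v) - {v}. D f u) \<le> (real (\<gamma> v) - 1) * d"
        unfolding eq card_siblings[OF vr, symmetric]
        using M v level_chi level_parent[OF vr]
        by (intro norm_sum_deriv_le) (force intro: less_imp_le)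
      have c: "norm ((of_nat (\<gamma> v) - 1) * D f v) \<le> (real (\<gamma> v) - 1) * d"
      proof -
        have "norm (of_nat (\<gamma> v) - 1 :: complex) = real (\<gamma> v) - 1"
          using g1 by (metis abs_of_nonneg diff_ge_0_iff_ge norm_of_real of_real_diff of_real_1
              of_real_of_nat_eq)
        moreover have "norm (D f v) \<le> d" using M[of v] v by simp
        ultimately show ?thesis using g1 by (simp add: norm_mult mult_left_mono)
      qed
      have "norm (D (B f) v)
          \<le> real (\<gamma> v) * d + (real (\<gamma> v) - 1) * d + (real (\<gamma> v) - 1) * d + 0"
        unfolding tree_deriv_shift[OF vr] eq[symmetric]
        by (rule order_trans[OF norm_diff_add_add_le]) (intro add_mono a b c, simp)
      also have "\<dots> < (3 * real (\<gamma> v) + 1) * d" using d by (simp add: algebra_simps)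
      also have "\<dots> \<le> (3 * real G + 1) * d" using d gG by (intro mult_right_mono) auto
      also have "\<dots> = e" unfolding d_def by simp
      finally show ?thesis .
    qed
    then show ?thesis by blast
  qed
  then show ?thesis using Bf by (auto simp: little_Lip_def deriv_tendsto_0_iff)
qed

lemma little_Lip_subset_Lip: "little_Lip E r \<subseteq> Lip E r"
  by (auto simp: little_Lip_def)

lemma shift_linear:
  "B (\<lambda>v. f v + g v) = (\<lambda>v. B f v + B g v)" "B (\<lambda>v. c * f v) = (\<lambda>v. c * B f v)"
  by (auto simp: backward_shift_def sum.distrib sum_distrib_left)

lemma shift_bounded_if_jumps_vanish:
  assumes "\<exists>N. \<forall>v. N < lev v \<longrightarrow> \<gamma> v = \<gamma> (parent v)"
  shows "bounded_operator_on (Lip E r) (Lip_norm E r) B"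
    and "bounded_operator_on (little_Lip E r) (Lip_norm E r) B"
proof -
  obtain N where N: "\<And>v. N < lev v \<Longrightarrow> \<gamma> v = \<gamma> (parent v)" using assms by blast
  obtain G where G: "\<And>v. \<gamma> v \<le> G" using num_children_bounded_if_jumps_vanish[OF N] by blast
  obtain C where C: "\<And>v. v \<noteq> r \<Longrightarrow> \<bar>real (\<gamma> v) - real (\<gamma> (parent v))\<bar> * real (lev v) \<le> C"
    using assms unfolding jumps_vanish_iff_weighted_jumps_bounded by auto
  define m where "m = max (2 * real (\<gamma> r)) (3 * real G + C)"
  have "Lambda_term v \<le> m" if "v \<noteq> r" for v
  proof -
    have "real (\<gamma> v) \<le> real G" "real (\<gamma> (parent v)) \<le> real G" using G by auto
    then show ?thesis using C[OF that] unfolding Lambda_term_def m_def by linarith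
  qed
  moreover have "2 * real (\<gamma> r) \<le> m" by (simp add: m_def)
  ultimately have le: "B f \<in> Lip E r" "Lip_norm E r (B f) \<le> m * Lip_norm E r f"
    if "f \<in> Lip E r" for f
    using shift_Lip_norm_le[of m f] that by auto
  show "bounded_operator_on (Lip E r) (Lip_norm E r) B"
    using le by (auto simp: bounded_operator_on_def shift_linear)
  have "B f \<in> little_Lip E r" if "f \<in> little_Lip E r" for f
    using shift_little_Lip[of N G f, OF N G] that le(1) little_Lip_subset_Lip by blast
  then show "bounded_operator_on (little_Lip E r) (Lip_norm E r) B"
    using le little_Lip_subset_Lip by (fastforce simp: bounded_operator_on_def shift_linear)
qed

section \<open>Boundedness implies homogeneity\<close>

lemma num_children_le_if_shift_bounded:
  assumes B: "\<And>f. f \<in> little_Lip E r \<Longrightarrow> B f \<in> Lip E r"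
    and C: "\<And>f. f \<in> little_Lip E r \<Longrightarrow> Lip_norm E r (B f) \<le> C * Lip_norm E r f"
    and "0 \<le> C"
  shows "real (\<gamma> v) \<le> C"
proof -
  define f :: "'a \<Rightarrow> complex" where "f = (\<lambda>w. of_bool (w \<in> chi v))"
  have bound: "norm (D f w) \<le> 1" for w by (simp add: tree_deriv_def f_def)
  have "D f w = 0" if w: "lev v + 3 \<le> lev w" for w
  proof -
    have "w \<noteq> r" using w by auto
    moreover from this have "w \<notin> chi v" "parent w \<notin> chi v"
      using w level_chi[of w v] level_chi[of "parent w" v] level_parent[of w] by auto
    ultimately show ?thesis by (simp add: tree_deriv_def f_def)
  qed
  then have f: "f \<in> little_Lip E r" using little_LipI[of f, OF bound] by blast
  have "B f v = of_nat (\<gamma> v)"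
    by (simp add: backward_shift_def f_def num_children_def)
  moreover have "B f (parent v) = 0" if "v \<noteq> r"
  proof -
    have "f w = 0" if "w \<in> chi (parent v)" for w
      using that level_chi[of w "parent v"] level_chi[of w v] level_parent[OF \<open>v \<noteq> r\<close>]
      by (auto simp: f_def)
    then show ?thesis by (simp add: backward_shift_def)
  qed
  ultimately have "D (B f) v = of_nat (\<gamma> v)"
    by (cases "v = r") (simp_all add: tree_deriv_def)
  then have "real (\<gamma> v) \<le> Lip_norm E r (B f)"
    using norm_deriv_le_Lip_norm[OF B[OF f], of v] by simp
  also have "\<dots> \<le> C * Lip_norm E r f" using C[OF f] .
  also have "\<dots> \<le> C * 1"
    using Lip_and_norm_leI(2)[of f, OF bound] \<open>0 \<le> C\<close> by (intro mult_left_mono)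
  finally show ?thesis by simp
qed

text \<open>The level function itself would give the estimate for all \<open>v\<close> at once, but its derivative does
  not decay.  Capping it at the level of the children of \<open>v\<close> changes \<open>B f\<close> neither at \<open>v\<close> nor at
  the parent of \<open>v\<close>.  The capped function yields a jump term plus \<open>\<gamma> v\<close>, and the latter is
  controlled by the preceding lemma.\<close>

lemma jumps_bounded_if_shift_bounded:
  assumes B: "\<And>f. f \<in> little_Lip E r \<Longrightarrow> B f \<in> Lip E r"
    and C: "\<And>f. f \<in> little_Lip E r \<Longrightarrow> Lip_norm E r (B f) \<le> C * Lip_norm E r f"
  shows "\<exists>C. \<forall>v\<in>- {r}. \<bar>real (\<gamma> v) - real (\<gamma> (parent v))\<bar> * real (lev v) \<le> C"
proof -
  define C' where "C' = max C 0"
  have C'0: "0 \<le> C'" by (simp add: C'_def)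
  have C': "Lip_norm E r (B f) \<le> C' * Lip_norm E r f" if "f \<in> little_Lip E r" for f
  proof -
    have "f \<in> Lip E r" using that little_Lip_subset_Lip by blast
    then have "C * Lip_norm E r f \<le> C' * Lip_norm E r f"
      using Lip_norm_nonneg by (intro mult_right_mono) (auto simp: C'_def)
    then show ?thesis using C[OF that] by linarith
  qed
  have "\<bar>real (\<gamma> v) - real (\<gamma> (parent v))\<bar> * real (lev v) \<le> 2 * C'" if v: "v \<noteq> r" for v
  proof -
    define f :: "'a \<Rightarrow> complex" where "f = (\<lambda>w. of_nat (min (lev w) (Suc (lev v))))"
    have D: "D f w = of_bool (w \<noteq> r \<and> lev w \<le> Suc (lev v))" for w
      using level_parent[of w] by (cases "w = r") (auto simp: tree_deriv_def f_def min_def le_Suc_eq)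
    have bound: "norm (D f w) \<le> 1" for w by (simp add: D)
    have "D f w = 0" if "lev v + 2 \<le> lev w" for w using that by (simp add: D)
    then have f: "f \<in> little_Lip E r" using little_LipI[of f, OF bound] by blast
    have Bf: "B f u = of_nat (\<gamma> u * Suc (lev u))" if "lev u \<le> lev v" for u
    proof -
      have "B f u = (\<Sum>w\<in>chi u. of_nat (Suc (lev u)))"
        unfolding backward_shift_def using that level_chi
        by (intro sum.cong) (auto simp: f_def min_def)
      then show ?thesis by (simp add: num_children_def algebra_simps)
    qed
    have "D (B f) v = of_nat (\<gamma> v * Suc (lev v)) - of_nat (\<gamma> (parent v) * lev v)"
      using Bf[of v] Bf[of "parent v"] v level_parent[OF v] by (simp add: tree_deriv_def)
    also have "\<dots> = of_real ((real (\<gamma> v) - real (\<gamma> (parent v))) * real (lev v) + real (\<gamma> v))"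
      by (simp add: algebra_simps)
    finally have "\<bar>(real (\<gamma> v) - real (\<gamma> (parent v))) * real (lev v) + real (\<gamma> v)\<bar>
        \<le> Lip_norm E r (B f)"
      using norm_deriv_le_Lip_norm[OF B[OF f], of v] by (metis norm_of_real)
    also have "\<dots> \<le> C' * Lip_norm E r f" using C'[OF f] .
    also have "\<dots> \<le> C' * 1"
      using Lip_and_norm_leI(2)[of f, OF bound] C'0 by (intro mult_left_mono)
    finally have "\<bar>(real (\<gamma> v) - real (\<gamma> (parent v))) * real (lev v)\<bar> \<le> C' + real (\<gamma> v)"
      by linarith
    then show ?thesis
      using num_children_le_if_shift_bounded[of C' v, OF B C' C'0] by (simp add: abs_mult)
  qed
  then show ?thesis by auto
qed

section \<open>The equivalence and the norm estimate\<close>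

lemma operator_norm_on_shift_le:
  assumes X: "X \<subseteq> Lip E r" and zero: "(\<lambda>v. 0) \<in> X"
  shows "ereal (operator_norm_on X (Lip_norm E r) B)
    \<le> max (ereal (2 * real (\<gamma> r))) (Lambda_bound E r)" (is "_ \<le> ?M")
proof (cases ?M)
  case (real m)
  have m1: "2 * real (\<gamma> r) \<le> m"
    using real by (metis ereal_less_eq(3) max.cobounded1)
  have "ereal (Lambda_term v) \<le> ?M" if "v \<noteq> r" for v
  proof -
    have "ereal (Lambda_term v) \<le> Lambda_bound E r"
      unfolding Lambda_bound_def Lambda_term_def by (rule SUP_upper) (use that in simp)
    then show ?thesis by (simp add: le_max_iff_disj)
  qed
  then have m2: "\<And>v. v \<noteq> r \<Longrightarrow> Lambda_term v \<le> m" using real by simp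
  have "Lip_norm E r (B f) \<le> m" if "f \<in> X" "Lip_norm E r f \<le> 1" for f
  proof -
    have "Lip_norm E r (B f) \<le> m * Lip_norm E r f"
      using shift_Lip_norm_le(2)[OF m1 m2] that X by blast
    also have "\<dots> \<le> m * 1" using m1 that(2) by (intro mult_left_mono) auto
    finally show ?thesis by simp
  qed
  moreover have "Lip_norm E r (\<lambda>v. 0) \<le> 1"
    by (rule Lip_and_norm_leI(2)) (simp add: tree_deriv_def)
  ultimately have "operator_norm_on X (Lip_norm E r) B \<le> m"
    unfolding operator_norm_on_def using zero by (intro cSUP_least) auto
  then show ?thesis using real by simp
next
  case MInf
  then show ?thesis by (simp add: max_def split: if_splits)
qed simp

lemma zero_in_little_Lip: "(\<lambda>v. 0) \<in> little_Lip E r"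
  by (rule little_LipI[of _ 0 0]) (simp_all add: tree_deriv_def)

end

lemma SUP_ereal_less_PInf_iff:
  "(SUP v\<in>A. ereal (g v)) < \<infinity> \<longleftrightarrow> (\<exists>C. \<forall>v\<in>A. g v \<le> C)"
proof
  assume "(SUP v\<in>A. ereal (g v)) < \<infinity>"
  then obtain n :: nat where n: "(SUP v\<in>A. ereal (g v)) < ereal (real n)"
    using less_PInf_Ex_of_nat by auto
  have "g v \<le> real n" if "v \<in> A" for v
    using SUP_upper[OF that, of "\<lambda>v. ereal (g v)"] n
    by (metis ereal_less_eq(3) less_imp_le order_trans)
  then show "\<exists>C. \<forall>v\<in>A. g v \<le> C" by blast
next
  assume "\<exists>C. \<forall>v\<in>A. g v \<le> C"
  then obtain C where "\<forall>v\<in>A. g v \<le> C" by blast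
  then have "(SUP v\<in>A. ereal (g v)) \<le> ereal C" by (intro SUP_least) auto
  then show "(SUP v\<in>A. ereal (g v)) < \<infinity>" by (rule le_less_trans) simp
qed

theorem theorem4p10:
  fixes E :: "'a \<Rightarrow> 'a \<Rightarrow> bool" and r :: 'a
  assumes "is_tree E"
    and "locally_finite E"
    and "countable (UNIV :: 'a set)" and "infinite (UNIV :: 'a set)"
  shows
    "(bounded_operator_on (Lip E r) (Lip_norm E r) (backward_shift E r)
        \<longleftrightarrow> bounded_operator_on (little_Lip E r) (Lip_norm E r) (backward_shift E r)) \<and>
     (bounded_operator_on (little_Lip E r) (Lip_norm E r) (backward_shift E r)
        \<longleftrightarrow> homogeneous_by_sectors E r) \<and>
     (homogeneous_by_sectors E r
        \<longleftrightarrow> (SUP v\<in>- {r}. ereal (\<bar>real (num_children E r v) - real (num_children E r (par E r v))\<bar>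
                                * real (level E r v))) < \<infinity>) \<and>
     (bounded_operator_on (Lip E r) (Lip_norm E r) (backward_shift E r) \<longrightarrow>
        ereal (operator_norm_on (Lip E r) (Lip_norm E r) (backward_shift E r))
          \<le> max (ereal (2 * real (num_children E r r))) (Lambda_bound E r) \<and>
        ereal (operator_norm_on (little_Lip E r) (Lip_norm E r) (backward_shift E r))
          \<le> max (ereal (2 * real (num_children E r r))) (Lambda_bound E r))"
proof -
  interpret rooted_tree E r using assms by unfold_locales
  let ?bL = "bounded_operator_on (Lip E r) (Lip_norm E r) B"
  let ?bl = "bounded_operator_on (little_Lip E r) (Lip_norm E r) B"
  let ?jumps = "\<exists>C. \<forall>v\<in>- {r}. \<bar>real (\<gamma> v) - real (\<gamma> (parent v))\<bar> * real (lev v) \<le> C"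
  have homogeneous: "homogeneous_by_sectors E r \<longleftrightarrow> ?jumps"
    unfolding homogeneous_by_sectors_iff_jumps_vanish jumps_vanish_iff_weighted_jumps_bounded ..
  have "?bL \<Longrightarrow> ?jumps"
    using little_Lip_subset_Lip jumps_bounded_if_shift_bounded
    unfolding bounded_operator_on_def by (metis subsetD)
  moreover have "?bl \<Longrightarrow> ?jumps"
    using little_Lip_subset_Lip jumps_bounded_if_shift_bounded
    unfolding bounded_operator_on_def by (metis subsetD)
  moreover have "?jumps \<Longrightarrow> ?bL" and "?jumps \<Longrightarrow> ?bl"
    using shift_bounded_if_jumps_vanish
    unfolding jumps_vanish_iff_weighted_jumps_bounded by blast+
  ultimately have "?bL \<longleftrightarrow> ?bl" and "?bl \<longleftrightarrow> ?jumps" by blast+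
  then show ?thesis
    using homogeneous zero_in_little_Lip little_Lip_subset_Lip
    by (auto simp only: SUP_ereal_less_PInf_iff intro!: operator_norm_on_shift_le)
qed

end
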